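(* Let $H$ be a Hopf algebra over a field $k$ with antipode $S$. If $H$ is co-Frobenius, then $S$ is bijective.
   Context: $H^*=\mathrm{Hom}_k(H,k)$ is the dual algebra of the coalgebra $H$, with convolution product $(\alpha\beta)(h)=\alpha(h_1)\beta(h_2)$ (Sweedler notation $\Delta(h)=h_1\otimes h_2$). A left integral of $H$ is an element $\lambda\in H^*$ such that $\alpha\lambda=\alpha(1)\lambda$ for all $\alpha\in H^*$. The space of left integrals is denoted $\int_l$. $H$ is not assumed to be finite dimensional. A Hopf algebra $H$ is called co-Frobenius if it has a nonzero integral, i.e. $\int_l\neq 0$. (For Hopf algebras this is equivalent to being co-Frobenius as a coalgebra, i.e. to the existence of an injective morphism of left $H^*$-modules $H\to H^*$, and also to its right-hand version, the existence of an injective morphism of right $H^*$-modules $H\to H^*$.) *)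

theory Defs
  imports Complex_Main "HOL-Library.Poly_Mapping"
begin

text \<open>
  The tensor product of vector spaces is taken in its textbook form, as the quotient of the free
  vector space on tuples of vectors by the multilinearity relations. The scalar multiplication of
  the spaces is a term, so this quotient cannot be a type. Instead, tensors are represented by
  formal linear combinations of tuples, and equality of tensors is congruence modulo the subspace
  of relations. In particular, a linear map into a tensor product is given by a choice of
  representatives, and is required to be linear modulo the relations only.
\<close>

definition fscale :: "'k::field \<Rightarrow> ('x \<Rightarrow>\<^sub>0 'k) \<Rightarrow> ('x \<Rightarrow>\<^sub>0 'k)"
  where "fscale c t = Poly_Mapping.map ((*) c) t"

abbreviation pure :: "'x \<Rightarrow> ('x \<Rightarrow>\<^sub>0 'k::field)"
  where "pure x \<equiv> Poly_Mapping.single x 1"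

lemma lookup_fscale [simp]:
  "Poly_Mapping.lookup (fscale c t) x = c * Poly_Mapping.lookup t x"
  by (simp add: fscale_def Poly_Mapping.map.rep_eq when_def)

lemma vector_space_fscale: "vector_space (fscale :: 'k::field \<Rightarrow> ('x \<Rightarrow>\<^sub>0 'k) \<Rightarrow> ('x \<Rightarrow>\<^sub>0 'k))"
  by unfold_locales
    (auto intro!: poly_mapping_eqI simp: lookup_add algebra_simps)

text \<open>The linear extension of a function on the basis to the free vector space:\<close>

definition extend :: "('k::field \<Rightarrow> 'v \<Rightarrow> 'v) \<Rightarrow> ('x \<Rightarrow> 'v::ab_group_add) \<Rightarrow> ('x \<Rightarrow>\<^sub>0 'k) \<Rightarrow> 'v"
  where "extend s f t = (\<Sum>x\<in>Poly_Mapping.keys t. s (Poly_Mapping.lookup t x) (f x))"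

text \<open>
  Here \<open>f\<close> puts a vector into one slot of a tuple whose other entries are fixed; the set
  expresses linearity in that slot.
\<close>

definition slot_relations ::
  "('k::field \<Rightarrow> 'v \<Rightarrow> 'v) \<Rightarrow> ('v::ab_group_add \<Rightarrow> 'x) \<Rightarrow> ('x \<Rightarrow>\<^sub>0 'k) set"
  where "slot_relations s f =
    {pure (f (a + b)) - (pure (f a) + pure (f b)) | a b. True} \<union>
    {pure (f (s c a)) - fscale c (pure (f a)) | c a. True}"

definition relations2 ::
  "('k::field \<Rightarrow> 'v::ab_group_add \<Rightarrow> 'v) \<Rightarrow> ('v \<times> 'v \<Rightarrow>\<^sub>0 'k) set"
  where "relations2 s = module.span fscale
    ((\<Union>b. slot_relations s (\<lambda>a. (a, b))) \<union> (\<Union>a. slot_relations s (\<lambda>b. (a, b))))"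

definition relations3 ::
  "('k::field \<Rightarrow> 'v::ab_group_add \<Rightarrow> 'v) \<Rightarrow> ('v \<times> 'v \<times> 'v \<Rightarrow>\<^sub>0 'k) set"
  where "relations3 s = module.span fscale
    ((\<Union>b c. slot_relations s (\<lambda>a. (a, b, c))) \<union>
     (\<Union>a c. slot_relations s (\<lambda>b. (a, b, c))) \<union>
     (\<Union>a b. slot_relations s (\<lambda>c. (a, b, c))))"

definition tensor_eq2 ::
  "('k::field \<Rightarrow> 'v::ab_group_add \<Rightarrow> 'v) \<Rightarrow> ('v \<times> 'v \<Rightarrow>\<^sub>0 'k) \<Rightarrow> ('v \<times> 'v \<Rightarrow>\<^sub>0 'k) \<Rightarrow> bool"
  where "tensor_eq2 s t u \<longleftrightarrow> t - u \<in> relations2 s"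

definition tensor_eq3 ::
  "('k::field \<Rightarrow> 'v::ab_group_add \<Rightarrow> 'v) \<Rightarrow>
    ('v \<times> 'v \<times> 'v \<Rightarrow>\<^sub>0 'k) \<Rightarrow> ('v \<times> 'v \<times> 'v \<Rightarrow>\<^sub>0 'k) \<Rightarrow> bool"
  where "tensor_eq3 s t u \<longleftrightarrow> t - u \<in> relations3 s"

text \<open>\<open>(a \<otimes> b) (c \<otimes> d) = a c \<otimes> b d\<close>:\<close>

definition tensor_mult ::
  "('v::ring_1 \<times> 'v \<Rightarrow>\<^sub>0 'k::field) \<Rightarrow> ('v \<times> 'v \<Rightarrow>\<^sub>0 'k) \<Rightarrow> ('v \<times> 'v \<Rightarrow>\<^sub>0 'k)"
  where "tensor_mult t u =
    extend fscale (\<lambda>(a, b). extend fscale (\<lambda>(c, d). pure (a * c, b * d)) u) t"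

locale coalgebra = vector_space scale
  for scale :: "'k::field \<Rightarrow> 'h::ab_group_add \<Rightarrow> 'h" +
  fixes comult :: "'h \<Rightarrow> ('h \<times> 'h \<Rightarrow>\<^sub>0 'k)"
    and counit :: "'h \<Rightarrow> 'k"
  assumes comult_add: "tensor_eq2 scale (comult (a + b)) (comult a + comult b)"
    and comult_scale: "tensor_eq2 scale (comult (scale c a)) (fscale c (comult a))"
    and counit_linear: "Vector_Spaces.linear scale (*) counit"
    and coassoc: "tensor_eq3 scale
      (extend fscale (\<lambda>(a, b). extend fscale (\<lambda>(x, y). pure (x, y, b)) (comult a)) (comult h))
      (extend fscale (\<lambda>(a, b). extend fscale (\<lambda>(x, y). pure (a, x, y)) (comult b)) (comult h))"
    and counit_left: "extend scale (\<lambda>(a, b). scale (counit a) b) (comult h) = h"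
    and counit_right: "extend scale (\<lambda>(a, b). scale (counit b) a) (comult h) = h"
begin

definition dual :: "('h \<Rightarrow> 'k) set"
  where "dual = {\<alpha>. Vector_Spaces.linear scale (*) \<alpha>}"

definition convolution :: "('h \<Rightarrow> 'k) \<Rightarrow> ('h \<Rightarrow> 'k) \<Rightarrow> 'h \<Rightarrow> 'k"
  where "convolution \<alpha> \<beta> h = extend (*) (\<lambda>(a, b). \<alpha> a * \<beta> b) (comult h)"

end

locale bialgebra = coalgebra scale comult counit
  for scale :: "'k::field \<Rightarrow> 'h::ring_1 \<Rightarrow> 'h"
    and comult :: "'h \<Rightarrow> ('h \<times> 'h \<Rightarrow>\<^sub>0 'k)"
    and counit :: "'h \<Rightarrow> 'k" +
  assumes mult_scale_left: "scale c a * b = scale c (a * b)"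
    and mult_scale_right: "a * scale c b = scale c (a * b)"
    and comult_one: "tensor_eq2 scale (comult 1) (pure (1, 1))"
    and comult_mult: "tensor_eq2 scale (comult (a * b)) (tensor_mult (comult a) (comult b))"
    and counit_one: "counit 1 = 1"
    and counit_mult: "counit (a * b) = counit a * counit b"

locale hopf_algebra = bialgebra scale comult counit
  for scale :: "'k::field \<Rightarrow> 'h::ring_1 \<Rightarrow> 'h"
    and comult :: "'h \<Rightarrow> ('h \<times> 'h \<Rightarrow>\<^sub>0 'k)"
    and counit :: "'h \<Rightarrow> 'k" +
  fixes antipode :: "'h \<Rightarrow> 'h"
  assumes antipode_linear: "Vector_Spaces.linear scale scale antipode"
    and antipode_left: "extend scale (\<lambda>(a, b). antipode a * b) (comult h) = scale (counit h) 1"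
    and antipode_right: "extend scale (\<lambda>(a, b). a * antipode b) (comult h) = scale (counit h) 1"
begin

definition left_integrals :: "('h \<Rightarrow> 'k) set"
  where "left_integrals =
    {\<phi> \<in> dual. \<forall>\<alpha>\<in>dual. convolution \<alpha> \<phi> = (\<lambda>h. \<alpha> 1 * \<phi> h)}"

definition co_frobenius :: bool
  where "co_frobenius \<longleftrightarrow> (\<exists>\<phi>\<in>left_integrals. \<phi> \<noteq> (\<lambda>_. 0))"

end

end

theory Submission
  imports Defs
begin

text \<open>
  Let \<open>\<phi>\<close> be a nonzero left integral. From \<open>x\<^sub>1 \<phi>(x\<^sub>2) = \<phi>(x) 1\<close> one gets
  \<open>S(a\<^sub>1) \<phi>(a\<^sub>2 b) = b\<^sub>1 \<phi>(a b\<^sub>2)\<close> and \<open>x\<^sub>1 \<phi>(x\<^sub>2 S(h)) = \<phi>(x S(h\<^sub>1)) h\<^sub>2\<close>.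
  The first identity implies that \<open>\<phi>(H y) = 0\<close> only for \<open>y = 0\<close>. If a functional \<open>f\<close> vanishes
  on the image of \<open>S\<close>, it also gives \<open>\<phi>(a f(b\<^sub>1) b\<^sub>2) = 0\<close> for all \<open>a\<close>, so
  \<open>f(b\<^sub>1) b\<^sub>2 = 0\<close> and \<open>f(b) = 0\<close>: thus \<open>S\<close> is surjective. If \<open>S(h) = 0\<close>, the second identity
  gives \<open>\<phi>(x S(h\<^sub>1)) f(h\<^sub>2) = 0\<close> for all \<open>x\<close> and \<open>f\<close>, so \<open>S(h\<^sub>1) f(h\<^sub>2) = 0\<close> for all \<open>f\<close>.
  Therefore \<open>\<epsilon>(h) 1 = S(h\<^sub>1) h\<^sub>2 = 0\<close>; since \<open>h\<^sub>1 f(h\<^sub>2)\<close> is again in the kernel of \<open>S\<close>, also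
  \<open>f(h) = \<epsilon>(h\<^sub>1 f(h\<^sub>2)) = 0\<close> for all \<open>f\<close>, hence \<open>h = 0\<close>.
\<close>

section \<open>Linear extension and tensors as formal combinations\<close>

lemma extend_superset:
  assumes "vector_space s" "finite A" "Poly_Mapping.keys t \<subseteq> A"
  shows "extend s f t = (\<Sum>x\<in>A. s (Poly_Mapping.lookup t x) (f x))"
proof -
  interpret vector_space s by fact
  show ?thesis
    unfolding extend_def using assms(2,3)
    by (intro sum.mono_neutral_left) (auto simp: in_keys_iff)
qed

lemma linear_extend:
  fixes s :: "'k::field \<Rightarrow> 'v::ab_group_add \<Rightarrow> 'v" and f :: "'x \<Rightarrow> 'v"
  assumes "vector_space s"
  shows "Vector_Spaces.linear fscale s (extend s f)"
proof -
  interpret V: vector_space s by fact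
  interpret F: vector_space fscale by (rule vector_space_fscale)
  show ?thesis
  proof unfold_locales
    fix t u :: "'x \<Rightarrow>\<^sub>0 'k"
    let ?A = "Poly_Mapping.keys t \<union> Poly_Mapping.keys u"
    have "extend s f (t + u) = (\<Sum>x\<in>?A. s (Poly_Mapping.lookup (t + u) x) (f x))"
      by (rule extend_superset[OF assms]) (use Poly_Mapping.keys_add[of t u] in auto)
    also have "\<dots> = (\<Sum>x\<in>?A. s (Poly_Mapping.lookup t x) (f x)) +
        (\<Sum>x\<in>?A. s (Poly_Mapping.lookup u x) (f x))"
      by (simp add: lookup_add V.scale_left_distrib sum.distrib)
    also have "\<dots> = extend s f t + extend s f u"
      by (simp add: extend_superset[OF assms, of ?A])
    finally show "extend s f (t + u) = extend s f t + extend s f u" .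
  next
    fix c and t :: "'x \<Rightarrow>\<^sub>0 'k"
    have "extend s f (fscale c t) =
        (\<Sum>x\<in>Poly_Mapping.keys t. s (Poly_Mapping.lookup (fscale c t) x) (f x))"
      by (rule extend_superset[OF assms]) (auto simp: in_keys_iff)
    then show "extend s f (fscale c t) = s c (extend s f t)"
      by (simp add: extend_def V.scale_sum_right)
  qed
qed

lemma extend_pure [simp]:
  assumes "vector_space s"
  shows "extend s f (pure x) = f x"
proof -
  interpret vector_space s by fact
  show ?thesis by (simp add: extend_def)
qed

lemma extend_extend:
  assumes "vector_space s"
  shows "extend s f (extend fscale g t) = extend s (\<lambda>x. extend s f (g x)) t"
proof -
  interpret V: vector_space s by fact
  interpret E: Vector_Spaces.linear fscale s "extend s f" by (rule linear_extend) fact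
  show ?thesis
    unfolding extend_def[of fscale] by (simp add: E.sum E.scale extend_def[of s _ t])
qed

text \<open>Equality of tensors is membership of the difference in a span, so a linear map that
  kills the generating relations respects that equality.\<close>

lemma linear_eq_of_span:
  assumes f: "Vector_Spaces.linear s1 s2 f" and "\<And>r. r \<in> R \<Longrightarrow> f r = 0"
    and "t - u \<in> module.span s1 R"
  shows "f t = f u"
proof -
  interpret f: Vector_Spaces.linear s1 s2 f by fact
  have "f (t - u) = 0"
    using assms(2,3) by (rule f.eq_0_on_span)
  then show ?thesis by (simp add: f.diff)
qed

section \<open>Multilinear maps and separation by linear functionals\<close>

definition bilin :: "('k \<Rightarrow> 'v \<Rightarrow> 'v) \<Rightarrow> ('v \<Rightarrow> 'v \<Rightarrow> 'v::ab_group_add) \<Rightarrow> bool"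
  where "bilin s F \<longleftrightarrow>
    (\<forall>a a' b. F (a + a') b = F a b + F a' b) \<and> (\<forall>c a b. F (s c a) b = s c (F a b)) \<and>
    (\<forall>a b b'. F a (b + b') = F a b + F a b') \<and> (\<forall>c a b. F a (s c b) = s c (F a b))"

text \<open>Fixing the first argument covers slots two and three; fixing the second adds slot
  one.\<close>

definition trilin :: "('k \<Rightarrow> 'v \<Rightarrow> 'v) \<Rightarrow> ('v \<Rightarrow> 'v \<Rightarrow> 'v \<Rightarrow> 'v::ab_group_add) \<Rightarrow> bool"
  where "trilin s F \<longleftrightarrow> (\<forall>a. bilin s (F a)) \<and> (\<forall>b. bilin s (\<lambda>a c. F a b c))"

context vector_space
begin

lemma linear_iff:
  "Vector_Spaces.linear scale scale f \<longleftrightarrow>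
    (\<forall>a b. f (a + b) = f a + f b) \<and> (\<forall>c a. f (scale c a) = scale c (f a))"
  by (auto simp: Vector_Spaces.linear_def module_hom_def module_hom_axioms_def
      vector_space_axioms module_axioms)

lemma linear_functional_iff:
  "Vector_Spaces.linear scale (*) f \<longleftrightarrow>
    (\<forall>a b. f (a + b) = f a + f b) \<and> (\<forall>c a. f (scale c a) = c * f a)"
proof -
  interpret K: vector_space "(*) :: 'a \<Rightarrow> 'a \<Rightarrow> 'a"
    by unfold_locales (auto simp: algebra_simps)
  show ?thesis
    by (auto simp: Vector_Spaces.linear_def module_hom_def module_hom_axioms_def
        vector_space_axioms module_axioms K.vector_space_axioms K.module_axioms)
qed

text \<open>The universal property of the tensor product: a bilinear map sends each relation to 0,
  so its value does not depend on the representative.\<close>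

lemma extend_tensor_eq2:
  assumes "bilin scale F" "tensor_eq2 scale t u"
  shows "extend scale (\<lambda>(a, b). F a b) t = extend scale (\<lambda>(a, b). F a b) u"
proof -
  interpret E: Vector_Spaces.linear fscale scale "extend scale (\<lambda>(a, b). F a b)"
    by (rule linear_extend) unfold_locales
  show ?thesis
    using assms(2) unfolding tensor_eq2_def relations2_def
    by (rule linear_eq_of_span[OF E.linear_axioms, rotated])
      (use assms(1) in \<open>auto simp: slot_relations_def E.diff E.add E.scale bilin_def
          extend_pure[OF vector_space_axioms]\<close>)
qed

lemma extend_tensor_eq3:
  assumes "trilin scale F" "tensor_eq3 scale t u"
  shows "extend scale (\<lambda>(a, b, c). F a b c) t = extend scale (\<lambda>(a, b, c). F a b c) u"
proof -
  interpret E: Vector_Spaces.linear fscale scale "extend scale (\<lambda>(a, b, c). F a b c)"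
    by (rule linear_extend) unfold_locales
  show ?thesis
    using assms(2) unfolding tensor_eq3_def relations3_def
    by (rule linear_eq_of_span[OF E.linear_axioms, rotated])
      (use assms(1) in \<open>auto simp: slot_relations_def E.diff E.add E.scale bilin_def
          trilin_def extend_pure[OF vector_space_axioms]\<close>)
qed

text \<open>A basis of \<open>U\<close> stays independent when \<open>v\<close> is added; the
  functional is 1 at \<open>v\<close> and 0 on that basis.\<close>

lemma functional_separates:
  assumes "subspace U" "v \<notin> U"
  obtains f where "Vector_Spaces.linear scale (*) f" "\<And>u. u \<in> U \<Longrightarrow> f u = 0" "f v \<noteq> 0"
proof -
  interpret P: vector_space_pair scale "(*) :: 'a \<Rightarrow> 'a \<Rightarrow> 'a"
    by unfold_locales (auto simp: algebra_simps)
  obtain B where B: "B \<subseteq> U" "independent B" "U \<subseteq> span B"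
    by (rule basis_exists[of U]) blast
  have "span B \<subseteq> U"
    using B(1) assms(1) by (rule span_minimal)
  then have v: "v \<notin> span B"
    using assms(2) by blast
  then have "independent (insert v B)"
    using B(2) by (simp add: independent_insertI)
  then obtain f where f: "Vector_Spaces.linear scale (*) f"
    "\<forall>x\<in>insert v B. f x = (if x = v then 1 else 0)"
    using P.linear_independent_extend[of "insert v B" "\<lambda>x. if x = v then 1 else 0"] by blast
  interpret f: Vector_Spaces.linear scale "(*)" f by (rule f)
  have "f u = 0" if "u \<in> U" for u
  proof (rule f.eq_0_on_span)
    show "u \<in> span B" using that B(3) by blast
    show "f x = 0" if "x \<in> B" for x
      using f(2) v that span_base[of v B] by auto
  qed
  then show ?thesis
    using that[OF f(1)] f(2) by simp
qed

lemma eq_0_if_functionals_0: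
  assumes "\<And>f. Vector_Spaces.linear scale (*) f \<Longrightarrow> f v = 0"
  shows "v = 0"
proof (rule ccontr)
  assume "v \<noteq> 0"
  then have "v \<notin> {0}" by simp
  with subspace_single_0 show False
    by (rule functional_separates) (use assms in auto)
qed

text \<open>Contracting one leg of a tensor with all functionals loses nothing. Expanding each
  \<open>x i\<close> in a basis rewrites the sum with one term per basis vector \<open>e\<close>,
  and the coordinate at \<open>e\<close> is itself a functional.\<close>

lemma bilinear_sum_eq_0:
  assumes F: "bilin scale F" and I: "finite I"
    and 0: "\<And>f e. Vector_Spaces.linear scale (*) f \<Longrightarrow> F e (\<Sum>i\<in>I. scale (f (x i)) (y i)) = 0"
  shows "(\<Sum>i\<in>I. F (x i) (y i)) = 0"
proof -
  define B where "B = extend_basis {}"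
  have B: "independent B" "span B = UNIV"
    unfolding B_def by (simp_all add: independent_extend_basis span_extend_basis independent_empty)
  define r where "r = representation B"
  define E where "E = (\<Union>i\<in>I. {e. r (x i) e \<noteq> 0})"
  have E: "finite E"
    unfolding E_def r_def using I by (auto intro: finite_representation)
  have x: "(\<Sum>e\<in>E. scale (r (x i) e) e) = x i" if "i \<in> I" for i
  proof -
    have "(\<Sum>e\<in>E. scale (r (x i) e) e) = (\<Sum>e | r (x i) e \<noteq> 0. scale (r (x i) e) e)"
      using E that by (intro sum.mono_neutral_right) (auto simp: E_def)
    then show ?thesis
      using B by (simp add: r_def sum_nonzero_representation_eq)
  qed
  have r: "Vector_Spaces.linear scale (*) (\<lambda>v. r v e)" for e
    using B by (auto simp: linear_functional_iff r_def representation_add representation_scale)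
  have F1: "Vector_Spaces.linear scale scale (\<lambda>a. F a b)" for b
    using F by (simp add: linear_iff bilin_def)
  have F2: "Vector_Spaces.linear scale scale (F a)" for a
    using F by (simp add: linear_iff bilin_def)
  have F2_sum: "F a (sum g I) = (\<Sum>i\<in>I. F a (g i))" for a g
  proof -
    interpret Vector_Spaces.linear scale scale "F a" by (rule F2)
    show ?thesis by (rule sum)
  qed
  have "(\<Sum>i\<in>I. F (x i) (y i)) = (\<Sum>i\<in>I. F (\<Sum>e\<in>E. scale (r (x i) e) e) (y i))"
    by (simp add: x)
  also have "\<dots> = (\<Sum>i\<in>I. \<Sum>e\<in>E. F e (scale (r (x i) e) (y i)))"
  proof (intro sum.cong refl)
    fix i
    interpret Vector_Spaces.linear scale scale "\<lambda>a. F a (y i)" by (rule F1)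
    show "F (\<Sum>e\<in>E. scale (r (x i) e) e) (y i) = (\<Sum>e\<in>E. F e (scale (r (x i) e) (y i)))"
      using F by (simp add: sum scale bilin_def)
  qed
  also have "\<dots> = (\<Sum>e\<in>E. \<Sum>i\<in>I. F e (scale (r (x i) e) (y i)))"
    by (rule sum.swap)
  also have "\<dots> = (\<Sum>e\<in>E. F e (\<Sum>i\<in>I. scale (r (x i) e) (y i)))"
    by (simp add: F2_sum)
  also have "\<dots> = 0"
    by (simp add: 0[OF r])
  finally show ?thesis .
qed

end

section \<open>Sweedler calculus in a coalgebra\<close>

context coalgebra
begin

text \<open>In Sweedler notation, \<open>sweedler F h\<close> is \<open>F h\<^sub>1 h\<^sub>2\<close>. Scalar-valued expressions are
  multiplied by a vector, so that all values lie in \<open>H\<close>.\<close>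

definition sweedler :: "('h \<Rightarrow> 'h \<Rightarrow> 'h) \<Rightarrow> 'h \<Rightarrow> 'h"
  where "sweedler F h = extend scale (\<lambda>(a, b). F a b) (comult h)"

lemma sweedler_sum:
  "sweedler F h = (\<Sum>x\<in>Poly_Mapping.keys (comult h).
     scale (Poly_Mapping.lookup (comult h) x) (F (fst x) (snd x)))"
  by (simp add: sweedler_def extend_def case_prod_unfold)


lemma counit_add: "counit (a + b) = counit a + counit b"
  and counit_scale: "counit (scale c a) = c * counit a"
  using counit_linear by (auto simp: linear_functional_iff)

lemma sweedler_add:
  assumes "bilin scale F"
  shows "sweedler F (a + b) = sweedler F a + sweedler F b"
proof -
  interpret E: Vector_Spaces.linear fscale scale "extend scale (\<lambda>(a, b). F a b)"
    by (rule linear_extend) unfold_locales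
  show ?thesis
    unfolding sweedler_def using extend_tensor_eq2[OF assms comult_add] by (simp add: E.add)
qed

lemma sweedler_scale:
  assumes "bilin scale F"
  shows "sweedler F (scale c a) = scale c (sweedler F a)"
proof -
  interpret E: Vector_Spaces.linear fscale scale "extend scale (\<lambda>(a, b). F a b)"
    by (rule linear_extend) unfold_locales
  show ?thesis
    unfolding sweedler_def using extend_tensor_eq2[OF assms comult_scale] by (simp add: E.scale)
qed

lemma sweedler_add_fun: "sweedler (\<lambda>a b. F a b + G a b) h = sweedler F h + sweedler G h"
  by (simp add: sweedler_sum scale_right_distrib sum.distrib)

lemma sweedler_scale_fun: "sweedler (\<lambda>a b. scale c (F a b)) h = scale c (sweedler F h)"
  by (simp add: sweedler_sum scale_sum_right mult.commute)

lemma sweedler_scale_mult_fun: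
  "sweedler (\<lambda>a b. scale (c * g a b) (F a b)) h = scale c (sweedler (\<lambda>a b. scale (g a b) (F a b)) h)"
  "sweedler (\<lambda>a b. scale (g a b * c) (F a b)) h = scale c (sweedler (\<lambda>a b. scale (g a b) (F a b)) h)"
  by (simp_all add: sweedler_scale_fun mult.commute flip: scale_scale)

lemma sweedler_linear:
  assumes "Vector_Spaces.linear scale scale f"
  shows "sweedler (\<lambda>a b. f (F a b)) h = f (sweedler F h)"
proof -
  interpret f: Vector_Spaces.linear scale scale f by fact
  show ?thesis by (simp add: sweedler_sum f.sum f.scale)
qed

lemma sweedler_swap:
  "sweedler (\<lambda>a b. sweedler (F a b) h) g = sweedler (\<lambda>c d. sweedler (\<lambda>a b. F a b c d) g) h"
  by (simp add: sweedler_sum scale_sum_right sum.swap[of _ "Poly_Mapping.keys (comult h)"] mult.commute)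

lemma sweedler_coassoc:
  assumes "trilin scale F"
  shows "sweedler (\<lambda>a b. sweedler (\<lambda>x y. F x y b) a) h =
    sweedler (\<lambda>a b. sweedler (\<lambda>x y. F a x y) b) h"
  using extend_tensor_eq3[OF assms coassoc[of h]]
  by (simp add: extend_extend[OF vector_space_axioms] extend_pure[OF vector_space_axioms]
      sweedler_def case_prod_unfold)

lemma sweedler_counit_left:
  assumes "Vector_Spaces.linear scale scale f"
  shows "sweedler (\<lambda>a b. scale (counit a) (f b)) h = f h"
  using sweedler_linear[OF assms, of "\<lambda>a b. scale (counit a) b" h] counit_left[of h] assms
  by (simp add: sweedler_def linear_iff)

lemma sweedler_counit_right:
  assumes "Vector_Spaces.linear scale scale f"
  shows "sweedler (\<lambda>a b. scale (counit b) (f a)) h = f h"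
  using sweedler_linear[OF assms, of "\<lambda>a b. scale (counit b) a" h] counit_right[of h] assms
  by (simp add: sweedler_def linear_iff)

lemma sweedler_eq_0_left:
  assumes "bilin scale F"
    and "\<And>f e. f \<in> dual \<Longrightarrow> F e (sweedler (\<lambda>a b. scale (f a) b) h) = 0"
  shows "sweedler F h = 0"
proof -
  let ?K = "Poly_Mapping.keys (comult h)" and ?l = "Poly_Mapping.lookup (comult h)"
  \<comment> \<open>The coefficients of \<open>comult h\<close> are absorbed into the leg that the
    functional contracts.\<close>
  have "(\<Sum>x\<in>?K. F (scale (?l x) (fst x)) (snd x)) = 0"
  proof (rule bilinear_sum_eq_0[OF assms(1)])
    fix f e
    assume "Vector_Spaces.linear scale (*) f"
    then show "F e (\<Sum>x\<in>?K. scale (f (scale (?l x) (fst x))) (snd x)) = 0"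
      using assms(2)[of f e] by (simp add: dual_def sweedler_sum linear_functional_iff)
  qed simp
  then show ?thesis
    using assms(1) by (simp add: sweedler_sum bilin_def)
qed

lemma sweedler_eq_0_right:
  assumes "bilin scale F"
    and "\<And>f e. f \<in> dual \<Longrightarrow> F (sweedler (\<lambda>a b. scale (f b) a) h) e = 0"
  shows "sweedler F h = 0"
proof -
  let ?K = "Poly_Mapping.keys (comult h)" and ?l = "Poly_Mapping.lookup (comult h)"
  have "(\<Sum>x\<in>?K. F (fst x) (scale (?l x) (snd x))) = 0"
  \<comment> \<open>The arguments are exchanged so that the functional contracts the second
    leg.\<close>
  proof (rule bilinear_sum_eq_0[of "\<lambda>a b. F b a"])
    fix f e
    assume "Vector_Spaces.linear scale (*) f"
    then show "F (\<Sum>x\<in>?K. scale (f (scale (?l x) (snd x))) (fst x)) e = 0"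
      using assms(2)[of f e] by (simp add: dual_def sweedler_sum linear_functional_iff mult.commute)
  qed (use assms(1) in \<open>simp_all add: bilin_def\<close>)
  then show ?thesis
    using assms(1) by (simp add: sweedler_sum bilin_def)
qed

lemma functional_sweedler:
  assumes "f \<in> dual"
  shows "scale (f (sweedler F h)) v = sweedler (\<lambda>a b. scale (f (F a b)) v) h"
  by (rule sweedler_linear[symmetric])
    (use assms in \<open>simp add: dual_def linear_iff linear_functional_iff scale_left_distrib\<close>)

end

section \<open>Multiplicativity, counit and antipode in Sweedler form\<close>

context hopf_algebra
begin

lemma antipode_add: "antipode (a + b) = antipode a + antipode b"
  and antipode_scale: "antipode (scale c a) = scale c (antipode a)"
  using antipode_linear by (auto simp: linear_iff)

text \<open>These rewrites discharge the multilinearity conditions on nested Sweedler sums.\<close>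

lemmas multilinear_simps = linear_iff trilin_def bilin_def sweedler_add sweedler_scale sweedler_add_fun
  sweedler_scale_fun sweedler_scale_mult_fun antipode_add antipode_scale counit_add counit_scale
  mult_scale_left
  mult_scale_right scale_right_distrib scale_left_distrib distrib_left distrib_right
  mult.assoc

lemma sweedler_mult:
  assumes "bilin scale F"
  shows "sweedler F (a * b) =
    sweedler (\<lambda>a1 a2. sweedler (\<lambda>b1 b2. F (a1 * b1) (a2 * b2)) b) a"
  using extend_tensor_eq2[OF assms comult_mult[of a b]]
  by (simp add: extend_extend[OF vector_space_axioms] extend_pure[OF vector_space_axioms]
      sweedler_def case_prod_unfold tensor_mult_def)

lemma sweedler_one:
  assumes "bilin scale F"
  shows "sweedler F 1 = F 1 1"
  using extend_tensor_eq2[OF assms comult_one]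
  by (simp add: sweedler_def extend_pure[OF vector_space_axioms])

text \<open>Both sides equal \<open>f(h\<^sub>1) \<epsilon>(h\<^sub>2)\<close>.\<close>

lemma functional_counit_left:
  assumes "f \<in> dual"
  shows "counit (sweedler (\<lambda>a b. scale (f a) b) h) = f h"
proof -
  interpret f: Vector_Spaces.linear scale "(*)" f using assms by (simp add: dual_def)
  have "f h = f (sweedler (\<lambda>a b. scale (counit b) a) h)"
    using counit_right[of h] by (simp add: sweedler_def)
  \<comment> \<open>Sweedler sums take values in H, so scalars are compared as multiples of 1.
    Nothing is lost since 1 \<noteq> 0 in \<open>ring_1\<close>.\<close>
  also have "scale \<dots> 1 = scale (counit (sweedler (\<lambda>a b. scale (f a) b) h)) 1"
    using assms counit_linear
    by (simp add: functional_sweedler dual_def f.scale counit_scale mult.commute)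
  finally show ?thesis by simp
qed

lemma functional_counit_right:
  assumes "f \<in> dual"
  shows "counit (sweedler (\<lambda>a b. scale (f b) a) h) = f h"
proof -
  interpret f: Vector_Spaces.linear scale "(*)" f using assms by (simp add: dual_def)
  have "f h = f (sweedler (\<lambda>a b. scale (counit a) b) h)"
    using counit_left[of h] by (simp add: sweedler_def)
  also have "scale \<dots> 1 = scale (counit (sweedler (\<lambda>a b. scale (f b) a) h)) 1"
    using assms counit_linear
    by (simp add: functional_sweedler dual_def f.scale counit_scale mult.commute)
  finally show ?thesis by simp
qed

lemma sweedler_antipode_left:
  assumes "Vector_Spaces.linear scale scale f"
  shows "sweedler (\<lambda>a b. f (antipode a * b)) h = scale (counit h) (f 1)"
  using sweedler_linear[OF assms, of "\<lambda>a b. antipode a * b" h] antipode_left[of h] assms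
  by (simp add: sweedler_def linear_iff)

lemma sweedler_antipode_right:
  assumes "Vector_Spaces.linear scale scale f"
  shows "sweedler (\<lambda>a b. f (a * antipode b)) h = scale (counit h) (f 1)"
  using sweedler_linear[OF assms, of "\<lambda>a b. a * antipode b" h] antipode_right[of h] assms
  by (simp add: sweedler_def linear_iff)

text \<open>\<open>\<Delta>(S h\<^sub>1) (h\<^sub>2 \<otimes> 1) = 1 \<otimes> S h\<close>, the only consequence of \<open>\<Delta>(S h) = S h\<^sub>2 \<otimes> S h\<^sub>1\<close> that is
  needed. It follows from \<open>\<Delta>(S h\<^sub>1) \<Delta>(h\<^sub>2) = \<epsilon>(h) 1 \<otimes> 1\<close> by multiplying with \<open>1 \<otimes> S h\<^sub>3\<close>.\<close>

lemma sweedler_antipode_mult: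
  assumes F: "bilin scale F"
  shows "sweedler (\<lambda>h1 h2. sweedler (\<lambda>u v. F (u * h2) v) (antipode h1)) h = F 1 (antipode h)"
proof -
  note F' = F[unfolded bilin_def, rule_format]
  \<comment> \<open>The element \<open>a\<close> is written as
    \<open>a\<^sub>1 \<epsilon>(a\<^sub>2)\<close>, and the counit is replaced by
    \<open>a\<^sub>2 S(a\<^sub>3)\<close> in the second slot.\<close>
  have expand: "F (u * a) v = sweedler (\<lambda>c q. sweedler (\<lambda>a p. F (u * a) (v * p * antipode q)) c) a" for u v a
  proof -
    have "F (u * a) v = sweedler (\<lambda>a b. scale (counit b) (F (u * a) v)) a"
      by (rule sweedler_counit_right[symmetric]) (simp add: multilinear_simps F')
    also have "\<dots> = sweedler (\<lambda>a b. sweedler (\<lambda>p q. F (u * a) (v * (p * antipode q))) b) a"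
      by (subst sweedler_antipode_right) (simp_all add: multilinear_simps F')
    also have "\<dots> = sweedler (\<lambda>c q. sweedler (\<lambda>a p. F (u * a) (v * (p * antipode q))) c) a"
      by (rule sweedler_coassoc[symmetric]) (simp add: multilinear_simps F')
    finally show ?thesis by (simp add: mult.assoc)
  qed
  have "sweedler (\<lambda>h1 h2. sweedler (\<lambda>u v. F (u * h2) v) (antipode h1)) h =
      sweedler (\<lambda>h1 h2. sweedler (\<lambda>u v. sweedler (\<lambda>c q. sweedler
        (\<lambda>a p. F (u * a) (v * p * antipode q)) c) h2) (antipode h1)) h"
    by (subst expand) (rule refl)
  also have "\<dots> = sweedler (\<lambda>h1 h2. sweedler (\<lambda>c q. sweedler (\<lambda>u v. sweedler
        (\<lambda>a p. F (u * a) (v * p * antipode q)) c) (antipode h1)) h2) h"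
    by (subst sweedler_swap) (rule refl)
  \<comment> \<open>Multiplicativity merges the two inner sums into the coproduct of
    \<open>antipode h1 * c\<close>; coassociativity then lets this product collapse to a
    counit.\<close>
  also have "\<dots> = sweedler (\<lambda>h1 h2. sweedler (\<lambda>c q.
      sweedler (\<lambda>s t. F s (t * antipode q)) (antipode h1 * c)) h2) h"
    by (subst sweedler_mult) (simp_all add: multilinear_simps F')
  also have "\<dots> = sweedler (\<lambda>w q. sweedler (\<lambda>h1 c.
      sweedler (\<lambda>s t. F s (t * antipode q)) (antipode h1 * c)) w) h"
    by (rule sweedler_coassoc[symmetric]) (simp add: multilinear_simps F')
  also have "\<dots> = sweedler (\<lambda>w q. scale (counit w) (sweedler (\<lambda>s t. F s (t * antipode q)) 1)) h"
    by (subst sweedler_antipode_left) (simp_all add: multilinear_simps F')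
  also have "\<dots> = sweedler (\<lambda>w q. scale (counit w) (F 1 (antipode q))) h"
    by (subst sweedler_one) (simp_all add: multilinear_simps F')
  also have "\<dots> = F 1 (antipode h)"
    by (rule sweedler_counit_left) (simp add: multilinear_simps F')
  finally show ?thesis .
qed

section \<open>Identities for a left integral and nondegeneracy\<close>

context
  fixes \<phi>
  assumes integral: "\<phi> \<in> left_integrals"
begin

lemma integral_add: "\<phi> (a + b) = \<phi> a + \<phi> b"
  and integral_scale: "\<phi> (scale c a) = c * \<phi> a"
  using integral by (auto simp: left_integrals_def dual_def linear_functional_iff)

lemmas integral_simps = multilinear_simps integral_add integral_scale

text \<open>Applying any functional \<open>f\<close> to both sides gives the defining equation of a
  left integral, and functionals separate vectors.\<close>

lemma sweedler_integral: "sweedler (\<lambda>a b. scale (\<phi> b) a) h = scale (\<phi> h) 1"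
proof -
  have "sweedler (\<lambda>a b. scale (\<phi> b) a) h - scale (\<phi> h) 1 = 0"
  proof (rule eq_0_if_functionals_0)
    fix f
    assume f: "Vector_Spaces.linear scale (*) f"
    interpret f: Vector_Spaces.linear scale "(*)" f by fact
    have "convolution f \<phi> h = f 1 * \<phi> h"
      using integral f by (auto simp: left_integrals_def dual_def)
    moreover have "convolution f \<phi> h = f (sweedler (\<lambda>a b. scale (\<phi> b) a) h)"
      by (simp add: convolution_def extend_def sweedler_sum f.scale f.sum case_prod_unfold)
        (simp only: ac_simps)
    ultimately show "f (sweedler (\<lambda>a b. scale (\<phi> b) a) h - scale (\<phi> h) 1) = 0"
      by (simp add: f.diff f.scale)
  qed
  then show ?thesis by simp
qed

text \<open>Invariance of \<phi> at \<open>a\<^sub>2 b\<close> turns the left side into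
  \<open>S(a\<^sub>1) a\<^sub>2 b\<^sub>1 \<phi>(a\<^sub>3 b\<^sub>2)\<close>, where the first two
  factors collapse to a counit.\<close>

lemma integral_mult_left:
  "sweedler (\<lambda>a1 a2. scale (\<phi> (a2 * b)) (antipode a1)) a =
    sweedler (\<lambda>b1 b2. scale (\<phi> (a * b2)) b1) b"
proof -
  have expand: "scale (\<phi> (a2 * b)) (antipode a1) =
      sweedler (\<lambda>x y. sweedler (\<lambda>b1 b2. scale (\<phi> (y * b2)) (antipode a1 * x * b1)) b) a2" for a1 a2
  proof -
    have "scale (\<phi> (a2 * b)) (antipode a1) =
        antipode a1 * sweedler (\<lambda>u v. scale (\<phi> v) u) (a2 * b)"
      by (simp add: sweedler_integral mult_scale_right)
    also have "\<dots> = sweedler (\<lambda>u v. antipode a1 * scale (\<phi> v) u) (a2 * b)"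
      by (rule sweedler_linear[symmetric]) (simp add: multilinear_simps)
    also have "\<dots> = sweedler (\<lambda>x y. sweedler
        (\<lambda>b1 b2. antipode a1 * scale (\<phi> (y * b2)) (x * b1)) b) a2"
      by (rule sweedler_mult) (simp add: integral_simps)
    finally show ?thesis by (simp add: mult_scale_right mult.assoc)
  qed
  have "sweedler (\<lambda>a1 a2. scale (\<phi> (a2 * b)) (antipode a1)) a =
      sweedler (\<lambda>a1 a2. sweedler (\<lambda>x y. sweedler
        (\<lambda>b1 b2. scale (\<phi> (y * b2)) (antipode a1 * x * b1)) b) a2) a"
    by (subst expand) (rule refl)
  also have "\<dots> = sweedler (\<lambda>w y. sweedler (\<lambda>a1 x. sweedler
        (\<lambda>b1 b2. scale (\<phi> (y * b2)) (antipode a1 * x * b1)) b) w) a"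
    by (rule sweedler_coassoc[symmetric]) (simp add: integral_simps)
  also have "\<dots> = sweedler (\<lambda>w y. scale (counit w) (sweedler
        (\<lambda>b1 b2. scale (\<phi> (y * b2)) (1 * b1)) b)) a"
    by (subst sweedler_antipode_left[where
          f = "\<lambda>z. sweedler (\<lambda>b1 b2. scale (\<phi> (_ * b2)) (z * b1)) b"])
      (simp_all add: integral_simps)
  also have "\<dots> = sweedler (\<lambda>b1 b2. scale (\<phi> (a * b2)) (1 * b1)) b"
    by (rule sweedler_counit_left) (simp add: integral_simps)
  finally show ?thesis by simp
qed

text \<open>Invariance at \<open>x S(h\<^sub>1)\<close> produces the coproduct of
  \<open>S(h\<^sub>1)\<close> with its first leg multiplied by \<open>h\<^sub>2\<close>, exactly the
  form that \<open>sweedler_antipode_mult\<close> evaluates.\<close>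

lemma integral_mult_antipode:
  "sweedler (\<lambda>x1 x2. scale (\<phi> (x2 * antipode h)) x1) x =
    sweedler (\<lambda>h1 h2. scale (\<phi> (x * antipode h1)) h2) h"
proof -
  have expand: "scale (\<phi> (x * antipode h1)) h2 =
      sweedler (\<lambda>x1 x2. sweedler (\<lambda>u v. scale (\<phi> (x2 * v)) (x1 * (u * h2))) (antipode h1)) x" for h1 h2
  proof -
    have "scale (\<phi> (x * antipode h1)) h2 = sweedler (\<lambda>u v. scale (\<phi> v) u) (x * antipode h1) * h2"
      by (simp add: sweedler_integral mult_scale_left)
    also have "\<dots> = sweedler (\<lambda>u v. scale (\<phi> v) u * h2) (x * antipode h1)"
      by (rule sweedler_linear[symmetric, where f = "\<lambda>z. z * h2"]) (simp add: multilinear_simps)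
    also have "\<dots> = sweedler (\<lambda>x1 x2. sweedler
        (\<lambda>u v. scale (\<phi> (x2 * v)) (x1 * u) * h2) (antipode h1)) x"
      by (rule sweedler_mult) (simp add: integral_simps)
    finally show ?thesis by (simp add: mult_scale_left mult.assoc)
  qed
  have "sweedler (\<lambda>h1 h2. scale (\<phi> (x * antipode h1)) h2) h =
      sweedler (\<lambda>h1 h2. sweedler (\<lambda>x1 x2. sweedler
        (\<lambda>u v. scale (\<phi> (x2 * v)) (x1 * (u * h2))) (antipode h1)) x) h"
    by (subst expand) (rule refl)
  also have "\<dots> = sweedler (\<lambda>x1 x2. sweedler (\<lambda>h1 h2. sweedler
        (\<lambda>u v. scale (\<phi> (x2 * v)) (x1 * (u * h2))) (antipode h1)) h) x"
    by (rule sweedler_swap)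
  also have "\<dots> = sweedler (\<lambda>x1 x2. scale (\<phi> (x2 * antipode h)) (x1 * 1)) x"
    by (subst sweedler_antipode_mult[where F = "\<lambda>s t. scale (\<phi> (_ * t)) (_ * s)"])
      (simp_all add: integral_simps)
  finally show ?thesis by simp
qed

text \<open>Both sides are \<open>f(y\<^sub>1) \<phi>(a y\<^sub>2)\<close>. The right one has the
  form to which \<open>integral_mult_left\<close> applies.\<close>

lemma integral_mult_sweedler:
  assumes f: "f \<in> dual"
  shows "\<phi> (a * sweedler (\<lambda>p q. scale (f p) q) y) = f (sweedler (\<lambda>p q. scale (\<phi> (a * q)) p) y)"
proof -
  interpret f: Vector_Spaces.linear scale "(*)" f using f by (simp add: dual_def)
  have "a * sweedler (\<lambda>p q. scale (f p) q) y = sweedler (\<lambda>p q. a * scale (f p) q) y"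
    by (rule sweedler_linear[symmetric]) (simp add: multilinear_simps)
  then have "scale (\<phi> (a * sweedler (\<lambda>p q. scale (f p) q) y)) 1 =
      sweedler (\<lambda>p q. scale (\<phi> (a * scale (f p) q)) 1) y"
    using integral by (simp add: functional_sweedler left_integrals_def)
  also have "\<dots> = sweedler (\<lambda>p q. scale (f (scale (\<phi> (a * q)) p)) 1) y"
    by (simp add: mult_scale_right integral_scale f.scale mult.commute)
  also have "\<dots> = scale (f (sweedler (\<lambda>p q. scale (\<phi> (a * q)) p) y)) 1"
    by (rule functional_sweedler[OF f, symmetric])
  finally show ?thesis by simp
qed

text \<open>The left ideal \<open>N = {y. \<phi>(H y) = 0}\<close> is stable under \<open>y \<mapsto> f(y\<^sub>1) y\<^sub>2\<close>, so it contains
  \<open>S(y\<^sub>1) y\<^sub>2 = \<epsilon>(y) 1\<close>. Hence \<open>\<epsilon>\<close> vanishes on \<open>N\<close>, and so does every \<open>f(y) = \<epsilon>(f(y\<^sub>1) y\<^sub>2)\<close>.\<close>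

lemma integral_nondegenerate:
  assumes nonzero: "\<phi> z \<noteq> 0" and y: "\<And>a. \<phi> (a * y) = 0"
  shows "y = 0"
proof -
  have stable: "\<phi> (a * sweedler (\<lambda>p q. scale (f p) q) y) = 0"
    if y: "\<And>a. \<phi> (a * y) = 0" and f: "f \<in> dual" for a f y
  proof -
    interpret f: Vector_Spaces.linear scale "(*)" f using f by (simp add: dual_def)
    \<comment> \<open>The value becomes \<open>f\<close> at
      \<open>S(a\<^sub>1) \<phi>(a\<^sub>2 y)\<close>, whose coefficients all vanish.\<close>
    show ?thesis
      unfolding integral_mult_sweedler[OF f] integral_mult_left[symmetric]
      by (simp add: y sweedler_sum)
  qed
  have counit_0: "counit y = 0" if y: "\<And>a. \<phi> (a * y) = 0" for y
  proof -
    have "sweedler (\<lambda>p q. scale (\<phi> (z * (antipode p * q))) 1) y = 0"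
    proof (rule sweedler_eq_0_left)
      show "bilin scale (\<lambda>p q. scale (\<phi> (z * (antipode p * q))) 1)"
        by (simp add: integral_simps)
      show "scale (\<phi> (z * (antipode e * sweedler (\<lambda>p q. scale (f p) q) y))) 1 = 0"
        if "f \<in> dual" for f e
        using stable[OF y that, of "z * antipode e"] by (simp add: mult.assoc)
    qed
    \<comment> \<open>Since \<open>S(y\<^sub>1) y\<^sub>2\<close> collapses, the sum is
      \<open>\<epsilon>(y) \<phi>(z) 1\<close>, and \<phi>(z) \<noteq> 0 cancels.\<close>
    moreover have "sweedler (\<lambda>p q. scale (\<phi> (z * (antipode p * q))) 1) y =
        scale (counit y) (scale (\<phi> (z * 1)) 1)"
      by (rule sweedler_antipode_left) (simp add: integral_simps)
    ultimately show ?thesis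
      using nonzero by simp
  qed
  show ?thesis
  proof (rule eq_0_if_functionals_0)
    fix f
    assume "Vector_Spaces.linear scale (*) f"
    then have f: "f \<in> dual" by (simp add: dual_def)
    show "f y = 0"
      using functional_counit_left[OF f, of y] counit_0[OF stable[OF y f]] by simp
  qed
qed

section \<open>Bijectivity of the antipode\<close>

lemma surj_antipode:
  assumes nonzero: "\<phi> z \<noteq> 0"
  shows "surj antipode"
proof (rule ccontr)
  assume "\<not> surj antipode"
  then obtain v where v: "v \<notin> range antipode" by blast
  have "subspace (range antipode)"
    by (rule module_hom.subspace_image[OF _ subspace_UNIV])
      (use antipode_linear in \<open>simp add: Vector_Spaces.linear_def\<close>)
  then obtain f where f: "f \<in> dual" "\<And>u. f (antipode u) = 0" "f v \<noteq> 0"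
    using v by (rule functional_separates) (auto simp: dual_def)
  have "\<phi> (a * sweedler (\<lambda>p q. scale (f p) q) v) = 0" for a
  proof -
    interpret f: Vector_Spaces.linear scale "(*)" f using f by (simp add: dual_def)
    \<comment> \<open>After rewriting, \<open>f\<close> is applied to a linear combination of values
      of the antipode.\<close>
    show ?thesis
      unfolding integral_mult_sweedler[OF f(1)] integral_mult_left[symmetric]
      by (simp add: sweedler_sum f.sum f.scale f(2))
  qed
  then have "sweedler (\<lambda>p q. scale (f p) q) v = 0"
    by (rule integral_nondegenerate[OF nonzero])
  \<comment> \<open>The instance \<open>counit_scale[of 0 0]\<close> supplies
    \<open>counit 0 = 0\<close>.\<close>
  then show False
    using functional_counit_left[OF f(1), of v] f(3) counit_scale[of 0 0] by simp
qed

lemma inj_antipode: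
  assumes nonzero: "\<phi> z \<noteq> 0"
  shows "inj antipode"
proof -
  have stable: "antipode (sweedler (\<lambda>p q. scale (f q) p) h) = 0"
    if h: "antipode h = 0" and f: "f \<in> dual" for f h
  proof (rule integral_nondegenerate[OF nonzero])
    fix x
    interpret f: Vector_Spaces.linear scale "(*)" f using f by (simp add: dual_def)
    have "x * antipode (sweedler (\<lambda>p q. scale (f q) p) h) =
        sweedler (\<lambda>p q. x * antipode (scale (f q) p)) h"
      by (rule sweedler_linear[symmetric]) (simp add: multilinear_simps)
    then have "scale (\<phi> (x * antipode (sweedler (\<lambda>p q. scale (f q) p) h))) 1 =
        sweedler (\<lambda>p q. scale (\<phi> (x * antipode (scale (f q) p))) 1) h"
      using integral by (simp add: functional_sweedler left_integrals_def)
    also have "\<dots> = sweedler (\<lambda>p q. scale (f (scale (\<phi> (x * antipode p)) q)) 1) h"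
      by (simp add: mult_scale_right antipode_scale integral_scale f.scale mult.commute)
    also have "\<dots> = scale (f (sweedler (\<lambda>p q. scale (\<phi> (x * antipode p)) q) h)) 1"
      by (rule functional_sweedler[OF f, symmetric])
    \<comment> \<open>By \<open>integral_mult_antipode\<close> this is
      \<open>x\<^sub>1 \<phi>(x\<^sub>2 S(h))\<close>, and \<open>S(h) = 0\<close>.\<close>
    also have "sweedler (\<lambda>p q. scale (\<phi> (x * antipode p)) q) h = 0"
      unfolding integral_mult_antipode[symmetric] using integral_scale[of 0 0]
      by (simp add: h sweedler_sum)
    finally show "\<phi> (x * antipode (sweedler (\<lambda>p q. scale (f q) p) h)) = 0"
      by simp
  qed
  have counit_0: "counit h = 0" if h: "antipode h = 0" for h
  proof -
    \<comment> \<open>Contracting the second leg leaves \<open>S(f(h\<^sub>2) h\<^sub>1) e\<close>,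
      which is 0 by \<open>stable\<close>.\<close>
    have "sweedler (\<lambda>p q. antipode p * q) h = 0"
      by (rule sweedler_eq_0_right) (simp_all add: multilinear_simps stable[OF h])
    then have "scale (counit h) 1 = 0"
      using antipode_left[of h] by (simp add: sweedler_def)
    then show ?thesis by simp
  qed
  have kernel: "h = 0" if h: "antipode h = 0" for h
  proof (rule eq_0_if_functionals_0)
    fix f
    assume "Vector_Spaces.linear scale (*) f"
    then have f: "f \<in> dual" by (simp add: dual_def)
    show "f h = 0"
      using functional_counit_right[OF f, of h] counit_0[OF stable[OF h f]] by simp
  qed
  show ?thesis
  proof (rule injI)
    fix a b
    assume "antipode a = antipode b"
    then have "antipode (a - b) = 0"
      using antipode_add[of "a - b" b] by simp
    then show "a = b"
      using kernel by force
  qed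
qed

end

end

theorem theorem3:
  fixes scale :: "'k::field \<Rightarrow> 'h::ring_1 \<Rightarrow> 'h"
    and comult :: "'h \<Rightarrow> ('h \<times> 'h \<Rightarrow>\<^sub>0 'k)"
    and counit :: "'h \<Rightarrow> 'k"
    and S :: "'h \<Rightarrow> 'h"
  assumes "hopf_algebra scale comult counit S"
    and "hopf_algebra.co_frobenius scale comult"
  shows "bij S"
proof -
  interpret hopf_algebra scale comult counit S by fact
  obtain \<phi> where \<phi>: "\<phi> \<in> left_integrals" "\<phi> \<noteq> (\<lambda>_. 0)"
    using assms(2) unfolding co_frobenius_def by blast
  then obtain z where "\<phi> z \<noteq> 0" by blast
  with \<phi>(1) show ?thesis
    by (intro bijI inj_antipode surj_antipode)
qed

end
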